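(* Let $k\ge3$ and $q\ge2$. Choose $0<\theta_1<\cdots<\theta_{k-2}<1$ such that $1,\theta_1,\dots,\theta_{k-2}$ are linearly independent over $\mathbb{Q}$, and consider the $(k+1)$-letter alphabet \[ A=\{0,\ q-1,\ q-1+\theta_1,\ \ldots,\ q-1+\theta_{k-2},\ q\}, \] which has short-relation rank one. Its exact minimum model diameter is \[ M_q(A)=q\,L_k(q). \]
   Context: A balanced vector is $\delta\in\mathbb{Z}^m$ with $\sum_i\delta_i=0$; its mass is $\sum_i\max(\delta_i,0)$. A $q$-relation is a balanced vector of mass at most $q$; it vanishes on $T=(t_0<\cdots<t_{m-1})$ if $\delta\cdot T:=\sum_i\delta_it_i=0$. The short-relation rank of $T$ is the dimension of the rational span of all $q$-relations vanishing on $T$. An order-preserving integer $q$-model of an ordered real alphabet $T=(t_0<\cdots<t_{m-1})$ is a strictly increasing integer tuple $T'=(t'_0<\cdots<t'_{m-1})$ such that for every balanced $\delta$ of mass at most $q$, $\delta\cdot T=0$ if and only if $\delta\cdot T'=0$; its diameter is $t'_{m-1}-t'_0$. $M_q(T)$ is the least diameter of an order-preserving integer $q$-model of $T$. For $k\ge3$, $L_k(q)$ is the least diameter of a $k$-element integer set on which no nonzero $q$-relation vanishes. *)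

theory Defs
  imports "HOL-Analysis.Analysis" "HOL-Library.Function_Algebras"
begin

text \<open>
  An alphabet \<open>t\<^sub>0 < \<dots> < t\<^bsub>m-1\<^esub>\<close> is a strictly sorted list of length \<open>m\<close>. A vector in \<open>\<int>\<^sup>m\<close>
  is a function on \<^typ>\<open>nat\<close> that vanishes outside \<open>{..<m}\<close>, so that distinct functions are
  distinct vectors.
\<close>

definition balanced :: "nat \<Rightarrow> (nat \<Rightarrow> int) \<Rightarrow> bool" where
  "balanced m \<delta> \<longleftrightarrow> (\<forall>i\<ge>m. \<delta> i = 0) \<and> (\<Sum>i<m. \<delta> i) = 0"

definition mass :: "nat \<Rightarrow> (nat \<Rightarrow> int) \<Rightarrow> int" where
  "mass m \<delta> = (\<Sum>i<m. max (\<delta> i) 0)"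

definition q_relations :: "nat \<Rightarrow> nat \<Rightarrow> (nat \<Rightarrow> int) set" where
  "q_relations q m = {\<delta>. balanced m \<delta> \<and> mass m \<delta> \<le> int q}"

definition rel_dot :: "(nat \<Rightarrow> int) \<Rightarrow> 'a::comm_ring_1 list \<Rightarrow> 'a" where
  "rel_dot \<delta> T = (\<Sum>i<length T. of_int (\<delta> i) * T ! i)"

interpretation rat_fun: vector_space "\<lambda>(c::rat) (v::nat \<Rightarrow> rat) i. c * v i"
  by unfold_locales (auto simp: fun_eq_iff algebra_simps)

interpretation rat_real: vector_space "\<lambda>(c::rat) (x::real). of_rat c * x"
  by unfold_locales (auto simp: algebra_simps of_rat_add of_rat_mult)

definition short_relation_rank :: "nat \<Rightarrow> real list \<Rightarrow> nat" where
  "short_relation_rank q T =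
     rat_fun.dim (rat_fun.span
       {(\<lambda>i. rat_of_int (\<delta> i)) |\<delta>. \<delta> \<in> q_relations q (length T) \<and> rel_dot \<delta> T = 0})"

definition integer_q_model :: "nat \<Rightarrow> real list \<Rightarrow> int list \<Rightarrow> bool" where
  "integer_q_model q T T' \<longleftrightarrow>
     length T' = length T \<and> sorted_wrt (<) T' \<and>
     (\<forall>\<delta>\<in>q_relations q (length T). rel_dot \<delta> T = 0 \<longleftrightarrow> rel_dot \<delta> T' = 0)"

definition min_model_diameter :: "nat \<Rightarrow> real list \<Rightarrow> nat" where
  "min_model_diameter q T =
     (LEAST d. \<exists>T'. integer_q_model q T T' \<and> int d = last T' - hd T')"

definition relation_free :: "nat \<Rightarrow> int set \<Rightarrow> bool" where
  "relation_free q S \<longleftrightarrow>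
     (\<forall>\<delta>\<in>q_relations q (card S). rel_dot \<delta> (sorted_list_of_set S) = 0 \<longrightarrow> (\<forall>i. \<delta> i = 0))"

definition min_free_diameter :: "nat \<Rightarrow> nat \<Rightarrow> nat" where
  "min_free_diameter k q =
     (LEAST d. \<exists>S. finite S \<and> card S = k \<and> relation_free q S \<and> int d = Max S - Min S)"

text \<open>
  The two minima above are taken over nonempty sets and hence attained.
\<close>

lemma q_relations_abs_le:
  assumes "\<delta> \<in> q_relations q m"
  shows "\<bar>\<delta> i\<bar> \<le> int q"
proof (cases "i < m")
  case True
  have bal: "(\<Sum>i<m. \<delta> i) = 0" and mass: "mass m \<delta> \<le> int q"
    using assms by (auto simp: q_relations_def balanced_def)
  have "(\<Sum>i<m. max (\<delta> i) 0) - (\<Sum>i<m. max (- \<delta> i) 0) = (\<Sum>i<m. \<delta> i)"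
    unfolding sum_subtractf[symmetric] by (rule sum.cong) auto
  then have neg: "(\<Sum>i<m. max (- \<delta> i) 0) = mass m \<delta>"
    using bal by (simp add: mass_def)
  have "max (\<delta> i) 0 \<le> (\<Sum>i<m. max (\<delta> i) 0)" "max (- \<delta> i) 0 \<le> (\<Sum>i<m. max (- \<delta> i) 0)"
    using True member_le_sum[of i "{..<m}" "\<lambda>i. max (\<delta> i) 0"]
      member_le_sum[of i "{..<m}" "\<lambda>i. max (- \<delta> i) 0"] by simp_all
  then show ?thesis using neg mass unfolding mass_def by linarith
next
  case False
  then show ?thesis using assms by (auto simp: q_relations_def balanced_def)
qed

lemma finite_q_relations: "finite (q_relations q m)"
proof (rule finite_subset)
  show "q_relations q m \<subseteq>
      {\<delta>. \<forall>i. (i \<in> {..<m} \<longrightarrow> \<delta> i \<in> {- int q..int q}) \<and> (i \<notin> {..<m} \<longrightarrow> \<delta> i = 0)}"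
  proof clarify
    fix \<delta> i assume d: "\<delta> \<in> q_relations q m"
    show "(i \<in> {..<m} \<longrightarrow> \<delta> i \<in> {- int q..int q}) \<and> (i \<notin> {..<m} \<longrightarrow> \<delta> i = 0)"
      using q_relations_abs_le[OF d, of i] d by (auto simp: q_relations_def balanced_def)
  qed
qed (rule finite_set_of_finite_funs; simp)

lemma integer_q_model_exists:
  fixes T :: "real list"
  assumes sorted: "sorted_wrt (<) T"
  shows "\<exists>T'. integer_q_model q T T'"
proof -
  define m where "m = length T"
  define F where "F = (\<lambda>\<delta>. \<bar>rel_dot \<delta> T\<bar>) ` {\<delta>\<in>q_relations q m. rel_dot \<delta> T \<noteq> 0}
     \<union> (\<lambda>(i,j). T ! j - T ! i) ` {(i,j). i < j \<and> j < m}"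
  have "{(i,j). i < j \<and> j < m} \<subseteq> {..<m} \<times> {..<m}" by auto
  then have fin: "finite F"
    unfolding F_def using finite_q_relations finite_subset by fastforce
  have pos: "\<forall>x\<in>F. x > 0"
    using sorted by (auto simp: F_def m_def sorted_wrt_iff_nth_less)
  define c where "c = Min (insert 1 F)"
  have c: "c > 0" "\<And>x. x \<in> F \<Longrightarrow> c \<le> x" "c \<le> 1"
    using fin pos by (auto simp: c_def)
  define K where "K = real m * real q + 2"
  have K: "K \<ge> 2" by (simp add: K_def)
  obtain N :: nat where N: "real N > K / c"
    using reals_Archimedean2 by blast
  have "N > 0" using N c K by (cases N) (auto simp: field_simps)
  have KN: "K / N < c" using N c \<open>N > 0\<close> by (simp add: field_simps)
  obtain Q p where Q: "0 < Q" and p: "\<And>i. i < m \<Longrightarrow> \<bar>of_int Q * (T ! i) - of_int (p i)\<bar> < 1/N"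
    using Dirichlet_approx_simult[OF \<open>N > 0\<close>, where n = m and \<theta> = "\<lambda>i. T ! i"] by blast
  define T' where "T' = map p [0..<m]"
  have len: "length T' = m" and nth: "\<And>i. i < m \<Longrightarrow> T' ! i = p i"
    by (auto simp: T'_def)
  have Q1: "real_of_int Q \<ge> 1" using Q by simp
  have big: "c \<le> real_of_int Q * x" if "x \<in> F" for x
  proof -
    have "1 * c \<le> real_of_int Q * x"
      using that c Q1 by (intro mult_mono) auto
    then show ?thesis by simp
  qed
  have "sorted_wrt (<) T'"
    unfolding sorted_wrt_iff_nth_less len
  proof (intro allI impI)
    fix i j assume ij: "i < j" "j < m"
    have "c \<le> real_of_int Q * (T ! j - T ! i)"
      using ij by (intro big) (force simp: F_def)
    moreover have "2 / N \<le> K / N" using K by (intro divide_right_mono) auto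
    ultimately have "real_of_int (p i) < real_of_int (p j)"
      using p[of i] p[of j] ij KN by (simp add: algebra_simps abs_less_iff)
    then show "T' ! i < T' ! j" using ij nth by simp
  qed
  moreover have "rel_dot \<delta> T = 0 \<longleftrightarrow> rel_dot \<delta> T' = 0" if d: "\<delta> \<in> q_relations q m" for \<delta>
  proof -
    have "\<bar>of_int Q * rel_dot \<delta> T - of_int (rel_dot \<delta> T')\<bar>
        = \<bar>\<Sum>i<m. of_int (\<delta> i) * (of_int Q * (T ! i) - of_int (p i))\<bar>"
      by (simp add: rel_dot_def len nth m_def[symmetric] sum_distrib_left sum_subtractf[symmetric]
          algebra_simps)
    also have "\<dots> \<le> (\<Sum>i<m. \<bar>of_int (\<delta> i) * (of_int Q * (T ! i) - of_int (p i))\<bar>)"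
      by (rule sum_abs)
    also have "\<dots> \<le> (\<Sum>i<m. real q * (1 / N))"
    proof (rule sum_mono)
      fix i assume "i \<in> {..<m}"
      then have "\<bar>of_int Q * (T ! i) - of_int (p i)\<bar> \<le> 1/N" using p[of i] by simp
      moreover have "\<bar>real_of_int (\<delta> i)\<bar> \<le> real q" using q_relations_abs_le[OF d, of i] by linarith
      ultimately show "\<bar>of_int (\<delta> i) * (of_int Q * (T ! i) - of_int (p i))\<bar> \<le> real q * (1 / N)"
        unfolding abs_mult by (intro mult_mono) auto
    qed
    also have "\<dots> < K / N" using \<open>N > 0\<close> by (simp add: K_def field_simps)
    finally have close: "\<bar>of_int Q * rel_dot \<delta> T - of_int (rel_dot \<delta> T')\<bar> < c"
      using KN by simp
    show ?thesis
    proof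
      assume "rel_dot \<delta> T = 0"
      then have "\<bar>real_of_int (rel_dot \<delta> T')\<bar> < 1" using close c by simp
      then show "rel_dot \<delta> T' = 0" by linarith
    next
      assume z: "rel_dot \<delta> T' = 0"
      show "rel_dot \<delta> T = 0"
      proof (rule ccontr)
        assume "rel_dot \<delta> T \<noteq> 0"
        then have "c \<le> real_of_int Q * \<bar>rel_dot \<delta> T\<bar>"
          using d by (intro big) (auto simp: F_def)
        then show False using close z Q1 by (simp add: abs_mult)
      qed
    qed
  qed
  ultimately have "integer_q_model q T T'"
    using len by (simp add: integer_q_model_def m_def)
  then show ?thesis ..
qed

lemma min_model_diameter_attained:
  fixes T :: "real list"
  assumes "sorted_wrt (<) T" "T \<noteq> []"
  shows "\<exists>T'. integer_q_model q T T' \<and> int (min_model_diameter q T) = last T' - hd T'"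
proof -
  obtain T' where T': "integer_q_model q T T'"
    using integer_q_model_exists assms by blast
  then have ne: "T' \<noteq> []" and s: "sorted_wrt (<) T'"
    using assms by (auto simp: integer_q_model_def)
  then have "hd T' \<le> last T'"
    by (cases T') (auto simp: less_imp_le)
  then have "int (nat (last T' - hd T')) = last T' - hd T'" by simp
  then show ?thesis
    unfolding min_model_diameter_def using T'
    by (intro LeastI[where P = "\<lambda>d. \<exists>T'. integer_q_model q T T' \<and> int d = last T' - hd T'"]) blast
qed

lemma power_digits_zero:
  fixes B :: int
  assumes "\<And>i. \<bar>f i\<bar> < B" "(\<Sum>i<k. f i * B ^ i) = 0" "i < k"
  shows "f i = 0"
  using assms
proof (induction k arbitrary: f i)
  case (Suc k)
  have e: "f 0 + B * (\<Sum>i<k. f (Suc i) * B ^ i) = 0"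
    using Suc.prems(2) unfolding sum.lessThan_Suc_shift by (simp add: sum_distrib_left mult_ac)
  then have "B dvd f 0"
    by (metis add_eq_0_iff2 dvd_minus_iff dvd_triv_left)
  then have z: "f 0 = 0"
    using Suc.prems(1)[of 0] by (metis abs_of_nonneg abs_ge_zero dvd_abs_iff abs_eq_0_iff
        zdvd_not_zless order_le_less)
  have "B > 0" using Suc.prems(1)[of 0] by linarith
  then have "(\<Sum>i<k. f (Suc i) * B ^ i) = 0" using e z by simp
  then have "\<And>j. j < k \<Longrightarrow> f (Suc j) = 0"
    using Suc.IH[of "\<lambda>i. f (Suc i)"] Suc.prems(1) by blast
  then show ?case using z Suc.prems(3) by (cases i) auto
qed simp

lemma min_free_diameter_attained:
  assumes "k > 0"
  shows "\<exists>S. finite S \<and> card S = k \<and> relation_free q S \<and>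
             int (min_free_diameter k q) = Max S - Min S"
proof (cases "q = 0")
  case True
  define S where "S = {0..<int k}"
  have fin: "finite S" and card: "card S = k" by (auto simp: S_def)
  have free: "relation_free q S"
    unfolding relation_free_def using q_relations_abs_le True by fastforce
  have "Min S \<le> Max S" using fin assms card
    by (metis Max_in Min_le card.empty less_irrefl)
  then have "int (nat (Max S - Min S)) = Max S - Min S" by simp
  then show ?thesis unfolding min_free_diameter_def using fin card free
    by (intro LeastI[where P = "\<lambda>d. \<exists>S. finite S \<and> card S = k \<and> relation_free q S \<and>
         int d = Max S - Min S"]) blast
next
  case False
  define B where "B = int q + 1"
  define L where "L = map (\<lambda>i. B ^ i) [0..<k]"
  define S where "S = set L"
  have B: "B > 1" using False by (simp add: B_def)
  have "sorted_wrt (<) L"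
    using B by (auto simp: L_def sorted_wrt_iff_nth_less intro!: power_strict_increasing)
  then have SL: "sorted_list_of_set S = L" and card: "card S = k" and fin: "finite S"
    by (auto simp: S_def L_def strict_sorted_iff sorted_list_of_set.idem_if_sorted_distinct
        distinct_card[symmetric] simp del: set_map dest: distinct_card)
  have "relation_free q S"
    unfolding relation_free_def SL card
  proof (intro ballI impI allI)
    fix \<delta> i assume d: "\<delta> \<in> q_relations q k" and z: "rel_dot \<delta> L = 0"
    have lt: "\<bar>\<delta> j\<bar> < B" for j
      using q_relations_abs_le[OF d, of j] by (simp add: B_def)
    have "(\<Sum>i<k. \<delta> i * B ^ i) = 0" using z by (simp add: rel_dot_def L_def)
    then have "i < k \<Longrightarrow> \<delta> i = 0"
      using power_digits_zero[of \<delta> B k i] lt by blast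
    then show "\<delta> i = 0" using d
      by (cases "i < k") (auto simp: q_relations_def balanced_def)
  qed
  moreover have "Min S \<le> Max S" using fin assms card
    by (metis Max_in Min_le card.empty less_irrefl)
  then have "int (nat (Max S - Min S)) = Max S - Min S" by simp
  ultimately show ?thesis unfolding min_free_diameter_def using fin card
    by (intro LeastI[where P = "\<lambda>d. \<exists>S. finite S \<and> card S = k \<and> relation_free q S \<and>
         int d = Max S - Min S"]) blast
qed

end

theory Submission
  imports Defs
begin

text \<open>
  Every relation on \<open>A\<close> is a multiple of \<open>\<rho> = (-1, q, 0, \<dots>, 0, 1 - q)\<close>, which has mass \<open>q\<close>. In a
  model \<open>T'\<close> of \<open>A\<close> the relation \<open>\<rho>\<close> says that the diameter is \<open>q\<close> times the diameter of the upper
  \<open>k\<close> letters, and these carry no short relation. Conversely, given a relation-free \<open>k\<close>-set of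
  diameter \<open>L\<close> and maximum \<open>a\<close>, add the letter \<open>a - q L\<close>. A short relation with positive coefficient
  on this letter must compensate at least \<open>q L\<close> with a negative part of mass at most \<open>q\<close> on
  letters at distance at most \<open>L\<close> from \<open>a\<close>; this is only possible with equality everywhere, which
  makes it a multiple of \<open>\<rho>\<close>.
\<close>

section \<open>The spanning relation \<rho> and elementary facts on short relations\<close>

definition pinch_relation :: "nat \<Rightarrow> nat \<Rightarrow> nat \<Rightarrow> int" where
  "pinch_relation k q i =
     (if i = 0 then - 1 else if i = 1 then int q else if i = k then 1 - int q else 0)"

lemma sum_lessThan_Suc_ends:
  fixes f :: "nat \<Rightarrow> 'a::comm_monoid_add"
  assumes "k \<ge> 2"
  shows "(\<Sum>i<Suc k. f i) = f 0 + (f 1 + (sum f {2..<k} + f k))"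
proof -
  have "{..<Suc k} = insert 0 (insert 1 (insert k {2..<k}))"
    using assms by auto
  then show ?thesis using assms by (simp add: add_ac)
qed

lemma rel_dot_Cons:
  "rel_dot \<delta> (x # xs) = of_int (\<delta> 0) * x + rel_dot (\<lambda>i. \<delta> (Suc i)) xs"
  by (simp add: rel_dot_def sum.lessThan_Suc_shift del: sum.lessThan_Suc)

lemma rel_dot_scale: "rel_dot (\<lambda>i. c * \<delta> i) T = of_int c * rel_dot \<delta> T"
  by (simp add: rel_dot_def sum_distrib_left mult_ac)

text \<open>A zero first coefficient adds nothing to the sum or to the mass. This moves relations
  between the whole alphabet and its upper letters, in both directions.\<close>

lemma q_relations_Suc_iff:
  assumes "\<delta> 0 = 0"
  shows "\<delta> \<in> q_relations q (Suc m) \<longleftrightarrow> (\<lambda>i. \<delta> (Suc i)) \<in> q_relations q m"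
proof -
  have "(\<forall>i\<ge>Suc m. \<delta> i = 0) \<longleftrightarrow> (\<forall>i\<ge>m. \<delta> (Suc i) = 0)"
    by (metis Suc_le_D Suc_le_mono)
  then show ?thesis
    using assms by (simp add: q_relations_def balanced_def mass_def sum.lessThan_Suc_shift
        del: sum.lessThan_Suc)
qed

lemma balanced_neg_mass:
  assumes "balanced m \<delta>"
  shows "(\<Sum>i<m. max (- \<delta> i) 0) = mass m \<delta>"
proof -
  have "mass m \<delta> - (\<Sum>i<m. max (- \<delta> i) 0) = (\<Sum>i<m. \<delta> i)"
    unfolding mass_def sum_subtractf[symmetric] by (rule sum.cong) auto
  then show ?thesis using assms by (simp add: balanced_def)
qed

text \<open>Negation swaps positive and negative parts, which have equal sums by balance. It reduces
  a negative \<open>\<delta> 0\<close> to a positive one.\<close>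

lemma q_relations_uminus:
  assumes "\<delta> \<in> q_relations q m"
  shows "(\<lambda>i. - \<delta> i) \<in> q_relations q m"
  using assms balanced_neg_mass[of m \<delta>]
  by (auto simp: q_relations_def balanced_def mass_def sum_negf)

lemma pinch_relation_in_q_relations:
  assumes "k \<ge> 2" "q \<ge> 1"
  shows "pinch_relation k q \<in> q_relations q (Suc k)"
  using assms
  by (auto simp: q_relations_def balanced_def mass_def pinch_relation_def sum_lessThan_Suc_ends
      simp del: sum.lessThan_Suc)

lemma rel_dot_pinch_relation:
  assumes "k \<ge> 2" "length T = Suc k"
  shows "rel_dot (pinch_relation k q) T = of_nat q * (T ! 1 - T ! k) + (T ! k - T ! 0)"
  using assms
  by (simp add: rel_dot_def pinch_relation_def sum_lessThan_Suc_ends algebra_simps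
      del: sum.lessThan_Suc)

text \<open>With the middle coefficients gone, balance and vanishing on \<open>T\<close> are two
  equations in \<open>\<delta> 0\<close>, \<open>\<delta> 1\<close>, \<open>\<delta> k\<close>. They
  are independent because \<open>T ! 1\<close> and \<open>T ! k\<close> differ, so the solutions
  form a line through \<rho>; the factor is \<open>- \<delta> 0\<close> since \<rho> starts with -1.
  The general ring covers both real alphabets and integer models.\<close>

lemma pinch_multiple:
  fixes T :: "'a::{idom,ring_char_0} list"
  assumes k: "k \<ge> 2" and len: "length T = Suc k" and bal: "balanced (Suc k) \<delta>"
    and ne: "T ! 1 \<noteq> T ! k" and pinch: "rel_dot (pinch_relation k q) T = 0"
    and dot: "rel_dot \<delta> T = 0" and mid: "\<And>i. 2 \<le> i \<Longrightarrow> i < k \<Longrightarrow> \<delta> i = 0"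
  shows "\<delta> = (\<lambda>i. - \<delta> 0 * pinch_relation k q i)"
proof -
  have b: "\<delta> 0 + (\<delta> 1 + \<delta> k) = 0"
    using bal mid by (simp add: balanced_def sum_lessThan_Suc_ends[OF k] del: sum.lessThan_Suc)
  then have dk: "\<delta> k = - \<delta> 0 - \<delta> 1" by simp
  have d: "of_int (\<delta> 0) * T ! 0 + (of_int (\<delta> 1) * T ! 1 + of_int (\<delta> k) * T ! k) = 0"
    using dot mid by (simp add: rel_dot_def len sum_lessThan_Suc_ends[OF k] del: sum.lessThan_Suc)
  have T0: "T ! 0 = of_nat q * (T ! 1 - T ! k) + T ! k"
    using pinch unfolding rel_dot_pinch_relation[OF k len] by (simp add: algebra_simps)
  have "of_int (int q * \<delta> 0 + \<delta> 1) * (T ! 1 - T ! k) = 0"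
    using d unfolding dk T0 by (simp add: algebra_simps)
  then have "(of_int (int q * \<delta> 0 + \<delta> 1) :: 'a) = 0"
    using ne by (metis mult_eq_0_iff right_minus_eq)
  then have d1: "\<delta> 1 = - int q * \<delta> 0"
    by (simp only: of_int_eq_0_iff)
  show ?thesis
  proof
    fix i
    consider "i = 0" | "i = 1" | "2 \<le> i" "i < k" | "i = k" | "i \<ge> Suc k" by linarith
    then show "\<delta> i = - \<delta> 0 * pinch_relation k q i"
      using k d1 dk mid bal
      by cases (auto simp: pinch_relation_def balanced_def algebra_simps)
  qed
qed

section \<open>Short relations on a relation-free set extended by a low letter\<close>

lemma relation_on_pinched_set_aux:
  fixes T :: "int list"
  assumes k: "k \<ge> 2" and len: "length T = Suc k" and sorted: "sorted_wrt (<) T"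
    and pinch: "rel_dot (pinch_relation k q) T = 0"
    and \<delta>: "\<delta> \<in> q_relations q (Suc k)" and dot: "rel_dot \<delta> T = 0" and pos: "\<delta> 0 > 0"
  shows "\<delta> = (\<lambda>i. - \<delta> 0 * pinch_relation k q i)"
proof (rule pinch_multiple[OF k len _ _ pinch dot])
  show bal: "balanced (Suc k) \<delta>" using \<delta> by (simp add: q_relations_def)
  have mono: "T ! i < T ! j" if "i < j" "j \<le> k" for i j
    using sorted that len by (simp add: sorted_wrt_iff_nth_less)
  show "T ! 1 \<noteq> T ! k" using mono[of 1 k] k by simp
  \<comment> \<open>Letters are measured by their distance \<open>g\<close> below the top letter. By
    \<open>h_eq\<close>, \<open>h i\<close> charges a positive coefficient its distance and a
    negative one its slack \<open>L - g i\<close>, so it is nonnegative on the upper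
    letters.\<close>
  define g where "g i = T ! k - T ! i" for i
  define L where "L = g 1"
  define h where "h i = \<delta> i * g i + max (- \<delta> i) 0 * L" for i
  have h_eq: "h i = max (\<delta> i) 0 * g i + max (- \<delta> i) 0 * (L - g i)" for i
    by (auto simp: h_def max_def algebra_simps)
  have L: "L > 0" using mono[of 1 k] k by (simp add: L_def g_def)
  have g: "0 \<le> g i \<and> g i \<le> L" if "i \<in> {1..k}" for i
    using mono[of i k] mono[of 1 i] that by (cases "i = k"; cases "i = 1") (auto simp: L_def g_def)
  have h_nonneg: "h i \<ge> 0" if "i \<in> {1..k}" for i
    using g[OF that] by (simp add: h_eq)
  have g0: "g 0 = int q * L"
    using pinch unfolding rel_dot_pinch_relation[OF k len] by (simp add: g_def L_def algebra_simps)
  have split: "(\<Sum>i<Suc k. f i) = f 0 + sum f {1..k}" for f :: "nat \<Rightarrow> int"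
  proof -
    have "{..<Suc k} = insert 0 {1..k}" by auto
    then show ?thesis by simp
  qed
  \<comment> \<open>Balance allows the origin to be moved to the top letter.\<close>
  have "(\<Sum>i<Suc k. \<delta> i * g i) = (\<Sum>i<Suc k. \<delta> i) * T ! k - rel_dot \<delta> T"
    unfolding rel_dot_def len g_def sum_distrib_right sum_subtractf[symmetric]
    by (rule sum.cong) (auto simp: algebra_simps)
  also have "\<dots> = 0"
    using dot bal by (simp add: balanced_def del: sum.lessThan_Suc)
  finally have "\<delta> 0 * g 0 + (\<Sum>i=1..k. \<delta> i * g i) = 0"
    unfolding split .
  \<comment> \<open>The lowest letter has a positive coefficient, so the whole negative part lies on
    the upper letters.\<close>
  moreover have "(\<Sum>i=1..k. max (- \<delta> i) 0) = mass (Suc k) \<delta>"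
    using balanced_neg_mass[OF bal] pos unfolding split by simp
  ultimately have "sum h {1..k} = (mass (Suc k) \<delta> - \<delta> 0 * int q) * L"
    by (simp add: h_def sum.distrib g0 algebra_simps flip: sum_distrib_left sum_distrib_right)
  also have "\<dots> \<le> 0"
  proof -
    have "1 * int q \<le> \<delta> 0 * int q" using pos by (intro mult_right_mono) auto
    moreover have "mass (Suc k) \<delta> \<le> int q" using \<delta> by (simp add: q_relations_def)
    ultimately show ?thesis using L by (intro mult_nonpos_nonneg) auto
  qed
  finally have "sum h {1..k} = 0"
    using sum_nonneg[of "{1..k}" h] h_nonneg by force
  then have h0: "h i = 0" if "i \<in> {1..k}" for i
    using sum_nonneg_eq_0_iff[of "{1..k}" h] h_nonneg that by auto
  show "\<delta> i = 0" if i: "2 \<le> i" "i < k" for i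
  proof -
    \<comment> \<open>Strictly between the end letters both distance and slack are positive, so
      \<open>h i = 0\<close> kills the positive and the negative part of
      \<open>\<delta> i\<close>.\<close>
    have "0 < g i" "g i < L" using mono[of i k] mono[of 1 i] i by (auto simp: g_def L_def)
    then show ?thesis
      using h0[of i] i by (auto simp: h_eq max_def split: if_splits)
  qed
qed

lemma relation_on_pinched_set:
  fixes T :: "int list"
  assumes k: "k \<ge> 2" and len: "length T = Suc k" and sorted: "sorted_wrt (<) T"
    and pinch: "rel_dot (pinch_relation k q) T = 0" and free: "relation_free q (set (tl T))"
    and \<delta>: "\<delta> \<in> q_relations q (Suc k)"
  shows "rel_dot \<delta> T = 0 \<longleftrightarrow> \<delta> = (\<lambda>i. - \<delta> 0 * pinch_relation k q i)"
proof
  assume "\<delta> = (\<lambda>i. - \<delta> 0 * pinch_relation k q i)"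
  then show "rel_dot \<delta> T = 0"
    using pinch by (metis rel_dot_scale mult_zero_right)
next
  assume dot: "rel_dot \<delta> T = 0"
  note aux = relation_on_pinched_set_aux[OF k len sorted pinch]
  consider "\<delta> 0 > 0" | "\<delta> 0 < 0" | "\<delta> 0 = 0" by linarith
  then show "\<delta> = (\<lambda>i. - \<delta> 0 * pinch_relation k q i)"
  proof cases
    case 1
    then show ?thesis using aux \<delta> dot by blast
  next
    case 2
    have "(\<lambda>i. - \<delta> i) = (\<lambda>i. - (- \<delta> 0) * pinch_relation k q i)"
      using aux[OF q_relations_uminus[OF \<delta>]] 2 dot rel_dot_scale[of "- 1" \<delta> T] by simp
    then have "- \<delta> i = \<delta> 0 * pinch_relation k q i" for i
      using fun_cong[of "\<lambda>i. - \<delta> i" _ i] by simp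
    then show ?thesis by (metis minus_minus mult_minus_left)
  next
    case 3
    \<comment> \<open>Without the lowest letter, \<delta> is a short relation on the relation-free
      upper letters, hence zero.\<close>
    obtain x b where T: "T = x # b" using len by (cases T) auto
    have b: "sorted_wrt (<) b" "length b = k" using sorted len by (auto simp: T)
    then have SL: "sorted_list_of_set (set b) = b" "card (set b) = k"
      by (auto simp: strict_sorted_iff sorted_list_of_set.idem_if_sorted_distinct distinct_card)
    have "rel_dot (\<lambda>i. \<delta> (Suc i)) b = 0" "(\<lambda>i. \<delta> (Suc i)) \<in> q_relations q k"
      using dot \<delta> q_relations_Suc_iff[of \<delta>] 3 by (auto simp: T rel_dot_Cons)
    then have "\<forall>i. \<delta> (Suc i) = 0"
      using free SL by (auto simp: T relation_free_def)
    then show ?thesis using 3 by (metis mult_zero_left neg_equal_zero not0_implies_Suc)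
  qed
qed

text \<open>A relation on the upper letters, extended by a zero on the lowest letter, is a multiple
  of \<rho> whose factor is that zero.\<close>

lemma relation_free_tl_of_pinched:
  fixes T :: "int list"
  assumes len: "length T = Suc k" and sorted: "sorted_wrt (<) T"
    and rels: "\<And>\<delta>. \<delta> \<in> q_relations q (Suc k) \<Longrightarrow> rel_dot \<delta> T = 0 \<Longrightarrow>
                 \<delta> = (\<lambda>i. - \<delta> 0 * pinch_relation k q i)"
  shows "relation_free q (set (tl T))"
proof -
  obtain x b where T: "T = x # b" using len by (cases T) auto
  have b: "sorted_wrt (<) b" "length b = k" using sorted len by (auto simp: T)
  then have SL: "sorted_list_of_set (set b) = b" "card (set b) = k"
    by (auto simp: strict_sorted_iff sorted_list_of_set.idem_if_sorted_distinct distinct_card)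
  show ?thesis
    unfolding relation_free_def T list.sel SL
  proof (intro ballI impI allI)
    fix \<delta> i assume d: "\<delta> \<in> q_relations q k" and z: "rel_dot \<delta> b = 0"
    define \<delta>' where "\<delta>' = case_nat 0 \<delta>"
    have \<delta>': "\<delta>' 0 = 0" "(\<lambda>i. \<delta>' (Suc i)) = \<delta>" by (auto simp: \<delta>'_def)
    then have "\<delta>' = (\<lambda>i. - \<delta>' 0 * pinch_relation k q i)"
      using d z q_relations_Suc_iff[of \<delta>'] by (intro rels) (auto simp: T rel_dot_Cons)
    then have "\<delta>' (Suc i) = 0" using \<delta>'(1) by (metis mult_zero_left neg_equal_zero)
    then show "\<delta> i = 0" by (simp add: \<delta>'_def)
  qed
qed

lemma rat_independent_int_combination:
  fixes \<theta> :: "'i \<Rightarrow> real" and c :: "'i \<Rightarrow> int"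
  assumes ind: "rat_real.independent (insert 1 (\<theta> ` I))" and "finite I" and inj: "inj_on \<theta> I"
    and one: "1 \<notin> \<theta> ` I" and zero: "of_int n + (\<Sum>j\<in>I. of_int (c j) * \<theta> j) = 0" and j: "j \<in> I"
  shows "c j = 0"
proof -
  define u :: "real \<Rightarrow> rat" where
    "u v = (if v = 1 then of_int n else of_int (c (inv_into I \<theta> v)))" for v
  have u: "u (\<theta> i) = of_int (c i)" if "i \<in> I" for i
    using that one inj by (auto simp: u_def)
  have "(\<Sum>v\<in>insert 1 (\<theta> ` I). of_rat (u v) * v) = of_rat (u 1) + (\<Sum>i\<in>I. of_rat (u (\<theta> i)) * \<theta> i)"
    using one \<open>finite I\<close> inj by (simp add: sum.reindex)
  also have "\<dots> = 0" using zero u by (simp add: u_def)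
  finally have "u (\<theta> j) = 0"
    using ind \<open>finite I\<close> j by (auto simp: rat_real.dependent_finite)
  then show ?thesis using u[OF j] by simp
qed

theorem theorem9p1:
  fixes k q :: nat and \<theta> :: "nat \<Rightarrow> real" and A :: "real list"
  assumes "k \<ge> 3" and "q \<ge> 2"
    and "strict_mono_on {1..k-2} \<theta>"
    and "\<And>i. i \<in> {1..k-2} \<Longrightarrow> 0 < \<theta> i \<and> \<theta> i < 1"
    and "rat_real.independent (insert 1 (\<theta> ` {1..k-2}))"
    and "A = [0, real q - 1] @ map (\<lambda>i. real q - 1 + \<theta> i) [1..<k-1] @ [real q]"
  shows "short_relation_rank q A = 1 \<and>
         min_model_diameter q A = q * min_free_diameter k q"
proof -

  \<comment> \<open>The letters of \<open>A\<close> and its short relations\<close>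
  have k: "k \<ge> 2" using assms(1) by simp
  define \<rho> where "\<rho> = pinch_relation k q"
  have len: "length A = Suc k" using assms(1) by (simp add: assms(6))
  have A0: "A ! 0 = 0" and A1: "A ! 1 = real q - 1" by (simp_all add: assms(6))
  have Ak: "A ! k = real q"
    using assms(1) by (simp add: assms(6) nth_append nth_Cons')
  have Amid: "A ! i = real q - 1 + \<theta> (i - 1)" if "i \<in> {2..<k}" for i
    using that by (auto simp: assms(6) nth_append nth_Cons' numeral_2_eq_2 Suc_diff_Suc)
  have "sorted_wrt (<) (map (\<lambda>i. real q - 1 + \<theta> i) [1..<k-1])"
    using strict_mono_onD[OF assms(3)] by (simp add: sorted_wrt_iff_nth_less)
  moreover have "0 < \<theta> i \<and> \<theta> i < 1" if "i \<in> set [1..<k-1]" for i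
    using assms(4)[of i] that by auto
  ultimately have sortedA: "sorted_wrt (<) A"
    using assms(2) by (auto simp: assms(6) sorted_wrt_append intro!: add_nonneg_pos)
  have \<rho>: "\<rho> \<in> q_relations q (Suc k)"
    unfolding \<rho>_def using k assms(2) by (intro pinch_relation_in_q_relations) auto
  have \<rho>A: "rel_dot \<rho> A = 0"
    unfolding \<rho>_def rel_dot_pinch_relation[OF k len] A0 A1 Ak by simp
  have relA: "rel_dot \<delta> A = 0 \<longleftrightarrow> \<delta> = (\<lambda>i. - \<delta> 0 * \<rho> i)" if \<delta>: "\<delta> \<in> q_relations q (Suc k)" for \<delta>
  proof
    assume "\<delta> = (\<lambda>i. - \<delta> 0 * \<rho> i)"
    then show "rel_dot \<delta> A = 0" using \<rho>A by (metis rel_dot_scale mult_zero_right)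
  next
    assume dot: "rel_dot \<delta> A = 0"
    have bal: "balanced (Suc k) \<delta>" using \<delta> by (simp add: q_relations_def)
    \<comment> \<open>The letter with index \<open>i\<close> carries \<theta> with index
      \<open>i - 1\<close>.\<close>
    have shift: "(\<Sum>i=2..<k. f i) = (\<Sum>j=1..k-2. f (Suc j))" for f :: "nat \<Rightarrow> real"
      using assms(1) by (intro sum.reindex_bij_witness[of _ Suc "\<lambda>i. i - 1"]) auto
    have "rel_dot \<delta> A = of_int (\<delta> 1) * (real q - 1)
        + ((\<Sum>i=2..<k. of_int (\<delta> i) * (real q - 1 + \<theta> (i - 1))) + of_int (\<delta> k) * real q)"
      by (simp add: rel_dot_def len sum_lessThan_Suc_ends[OF k] A0 A1[simplified] Ak Amid
          del: sum.lessThan_Suc)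
    \<comment> \<open>Separating the integer part from the \<theta> part lets rational independence
      annihilate every middle coefficient. The letter 0 contributes nothing here;
      \<open>\<delta> 0\<close> is tied to the others by balance.\<close>
    also have "\<dots> = of_int (\<delta> 1 * (int q - 1) + (\<Sum>i=2..<k. \<delta> i) * (int q - 1) + \<delta> k * int q)
        + (\<Sum>j=1..k-2. of_int (\<delta> (Suc j)) * \<theta> j)"
      by (simp add: shift distrib_left sum.distrib sum_distrib_right)
    finally have comb: "of_int (\<delta> 1 * (int q - 1) + (\<Sum>i=2..<k. \<delta> i) * (int q - 1) + \<delta> k * int q)
        + (\<Sum>j=1..k-2. of_int (\<delta> (Suc j)) * \<theta> j) = 0"
      using dot by simp
    have \<theta>1: "1 \<notin> \<theta> ` {1..k-2}" using assms(4) by force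
    have mid: "\<delta> i = 0" if i: "2 \<le> i" "i < k" for i
    proof -
      have "i - 1 \<in> {1..k-2}" "Suc (i - 1) = i" using i by auto
      then show ?thesis
        using rat_independent_int_combination[OF assms(5) _
            strict_mono_on_imp_inj_on[OF assms(3)] \<theta>1 comb, of "i - 1"] by simp
    qed
    show "\<delta> = (\<lambda>i. - \<delta> 0 * \<rho> i)"
      unfolding \<rho>_def using \<rho>A Ak A1 mid dot bal
      by (intro pinch_multiple[OF k len]) (auto simp: \<rho>_def)
  qed

  have rank: "short_relation_rank q A = 1"

  \<comment> \<open>Short-relation rank\<close>
  proof -
    define R where "R = (\<lambda>i. rat_of_int (\<rho> i))"
    define V where "V = {(\<lambda>i. rat_of_int (\<delta> i)) |\<delta>. \<delta> \<in> q_relations q (length A) \<and> rel_dot \<delta> A = 0}"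
    have "R \<in> V" using \<rho> \<rho>A by (auto simp: V_def R_def len)
    moreover have "V \<subseteq> rat_fun.span {R}"
    proof
      fix v assume "v \<in> V"
      then obtain \<delta> where v: "v = (\<lambda>i. rat_of_int (\<delta> i))"
        and "\<delta> \<in> q_relations q (Suc k)" "rel_dot \<delta> A = 0"
        unfolding V_def len by blast
      then have "\<delta> i = - \<delta> 0 * \<rho> i" for i
        using fun_cong[OF iffD1[OF relA]] by blast
      then have "v = (\<lambda>i. rat_of_int (- \<delta> 0) * R i)"
        unfolding R_def v of_int_mult[symmetric] by (intro ext arg_cong[where f = of_int])
      then show "v \<in> rat_fun.span {R}"
        using rat_fun.span_scale[OF rat_fun.span_base[OF singletonI[of R]]] by (simp only:)
    qed
    ultimately have "rat_fun.span V = rat_fun.span {R}"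
      unfolding rat_fun.span_eq by (simp add: rat_fun.span_base)
    moreover have "R 0 \<noteq> 0" by (simp add: R_def \<rho>_def pinch_relation_def)
    then have "R \<noteq> 0" by auto
    then have "rat_fun.dim (rat_fun.span {R}) = 1"
      by (simp add: rat_fun.dim_span rat_fun.dim_eq_card_independent)
    ultimately show ?thesis by (simp add: short_relation_rank_def V_def)
  qed

  have diam: "last T' - hd T' = T' ! k - T' ! 0" if "length T' = Suc k" for T' :: "int list"
    using that by (cases T') (auto simp: last_conv_nth)

  \<comment> \<open>Lower bound: the upper letters of an optimal model\<close>
  have "q * min_free_diameter k q \<le> min_model_diameter q A"
  proof -
    obtain T' where T': "integer_q_model q A T'" "int (min_model_diameter q A) = last T' - hd T'"
      using min_model_diameter_attained[OF sortedA] len by fastforce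
    then have T'l: "length T' = Suc k" and T's: "sorted_wrt (<) T'"
      and iff: "\<And>\<delta>. \<delta> \<in> q_relations q (Suc k) \<Longrightarrow> rel_dot \<delta> A = 0 \<longleftrightarrow> rel_dot \<delta> T' = 0"
      by (auto simp: integer_q_model_def len)
    define S where "S = set (tl T')"
    \<comment> \<open>The model has exactly the short relations of \<open>A\<close>, so all of them
      are multiples of \<rho>.\<close>
    have free: "relation_free q S"
      unfolding S_def using iff relA T'l T's
      by (intro relation_free_tl_of_pinched[of _ k]) (auto simp: \<rho>_def)
    have ne: "T' ! 1 < T' ! k" using T's T'l k by (simp add: sorted_wrt_iff_nth_less)
    obtain x b where T'b: "T' = x # b" using T'l by (cases T') auto
    have b: "sorted_wrt (<) b" "length b = k" "b \<noteq> []" using T's T'l k by (auto simp: T'b)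
    have card: "card S = k" using b by (auto simp: S_def T'b strict_sorted_iff distinct_card)
    have "Max S = T' ! k"
    proof (rule Max_eqI)
      show "T' ! k \<in> S" using T'l k by (auto simp: S_def T'b nth_Cons')
      fix y assume "y \<in> S"
      then obtain i where "i < k" "y = T' ! Suc i"
        using b by (auto simp: S_def T'b in_set_conv_nth)
      then show "y \<le> T' ! k"
        using T's T'l by (cases "Suc i = k") (auto simp: sorted_wrt_iff_nth_less less_imp_le)
    qed (simp add: S_def)
    moreover have "Min S = T' ! 1"
    proof (rule Min_eqI)
      show "T' ! 1 \<in> S" using T'l k by (auto simp: S_def T'b nth_Cons')
      fix y assume "y \<in> S"
      then obtain i where "i < k" "y = T' ! Suc i"
        using b by (auto simp: S_def T'b in_set_conv_nth)
      then show "T' ! 1 \<le> y"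
        using T's T'l by (cases "i = 0") (auto simp: sorted_wrt_iff_nth_less less_imp_le)
    qed (simp add: S_def)
    ultimately have "min_free_diameter k q \<le> nat (T' ! k - T' ! 1)"
      unfolding min_free_diameter_def using free card ne
      by (intro Least_le exI[of _ S]) (auto simp: S_def)
    then have "int q * int (min_free_diameter k q) \<le> int q * (T' ! k - T' ! 1)"
      using ne by (intro mult_left_mono) auto
    \<comment> \<open>This is the vanishing of \<rho> on the model.\<close>
    also have "\<dots> = T' ! k - T' ! 0"
      using \<rho>A iff[OF \<rho>] unfolding \<rho>_def rel_dot_pinch_relation[OF k T'l]
      by (simp add: algebra_simps)
    also have "\<dots> = int (min_model_diameter q A)"
      using T'(2) diam[OF T'l] by simp
    finally show ?thesis by (metis of_nat_le_iff of_nat_mult)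
  qed

  \<comment> \<open>Upper bound: extending an optimal relation-free set\<close>
  moreover have "min_model_diameter q A \<le> q * min_free_diameter k q"
  proof -
    obtain S where S: "finite S" "card S = k" "relation_free q S"
      "int (min_free_diameter k q) = Max S - Min S"
      using min_free_diameter_attained[of k q] k by auto
    define L where "L = int (min_free_diameter k q)"
    define b where "b = sorted_list_of_set S"
    \<comment> \<open>The added letter is the only value at which \<rho> vanishes on the extended
      list.\<close>
    define T' where "T' = (Max S - int q * L) # b"
    have bl: "length b = k" and bs: "sorted_wrt (<) b" and bS: "set b = S"
      using S by (auto simp: b_def)
    have "S \<noteq> {}" using S k by auto
    have b0: "b ! 0 = Min S"
      using sorted_list_of_set_nonempty[OF S(1) \<open>S \<noteq> {}\<close>] by (simp add: b_def)
    have bk: "b ! (k - 1) = Max S"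
    proof (rule Max_eqI[symmetric, OF S(1)])
      show "b ! (k - 1) \<in> S" using bS bl k by (metis diff_less nth_mem pos2 less_le_trans zero_less_one)
      fix y assume "y \<in> S"
      then obtain i where "i < k" "y = b ! i" using bS bl by (metis in_set_conv_nth)
      then show "y \<le> b ! (k - 1)"
        using bs bl by (cases "i = k - 1") (auto simp: sorted_wrt_iff_nth_less less_imp_le)
    qed
    have "b ! 0 < b ! (k - 1)" using bs bl k by (simp add: sorted_wrt_iff_nth_less)
    then have L: "L > 0" using b0 bk S(4) by (simp add: L_def)
    \<comment> \<open>Here \<open>q \<ge> 2\<close> places the added letter strictly below
      \<open>Min S\<close>.\<close>
    have "1 * L < int q * L" using L assms(2) by (intro mult_strict_right_mono) auto
    then have "Max S - int q * L < Min S" using S(4) by (simp add: L_def)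
    then have T's: "sorted_wrt (<) T'"
      using bs bS S(1) by (auto simp: T'_def intro: less_le_trans)
    have T'l: "length T' = Suc k" using bl by (simp add: T'_def)
    have T'n: "T' ! 0 = Max S - int q * L" "T' ! 1 = Min S" "T' ! k = Max S"
      using b0 bk k by (auto simp: T'_def nth_Cons')
    have free: "relation_free q (set (tl T'))" using S(3) bS by (simp add: T'_def)
    have pinch: "rel_dot (pinch_relation k q) T' = 0"
      unfolding rel_dot_pinch_relation[OF k T'l] T'n L_def S(4) by (simp add: algebra_simps)
    have "integer_q_model q A T'"
      unfolding integer_q_model_def len
    proof (intro conjI ballI)
      fix \<delta> assume "\<delta> \<in> q_relations q (Suc k)"
      \<comment> \<open>On both alphabets a short relation vanishes exactly when it is the same
        multiple of \<rho>.\<close>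
      then show "rel_dot \<delta> A = 0 \<longleftrightarrow> rel_dot \<delta> T' = 0"
        using relA relation_on_pinched_set[OF k T'l T's pinch free] unfolding \<rho>_def by blast
    qed (use T'l T's in auto)
    moreover have "int (q * min_free_diameter k q) = last T' - hd T'"
      unfolding diam[OF T'l] T'n by (simp add: L_def)
    ultimately show ?thesis
      unfolding min_model_diameter_def by (intro Least_le) auto
  qed
  ultimately show ?thesis using rank by simp
qed

end
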